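(* For a Banach lattice $E$ the following statements are equivalent. (1) $E$ is finite dimensional. (2) Every positive disjointly weakly compact operator $T:E\to \ell_\infty$ is $M$-weakly compact.
   Context: Banach lattices are real; $B_X$ is the closed unit ball of $X$. A sequence $(x_n)$ in a Banach lattice is disjoint if $|x_n|\wedge|x_m|=0$ for $n\neq m$. $Sol(A)=\{x: |x|\le |a| \text{ for some } a\in A\}$ is the solid hull of $A$. A norm bounded set $A$ in a Banach lattice is disjointly weakly compact if every disjoint sequence in $Sol(A)$ converges weakly to zero. A bounded linear operator $T$ from a Banach space $X$ to a Banach lattice is disjointly weakly compact if $T(B_X)$ is a disjointly weakly compact set. A continuous linear operator $T:E\to X$ from a Banach lattice to a Banach space is $M$-weakly compact if $\lim\|Tx_n\|=0$ for every norm bounded disjoint sequence $(x_n)\subset E$. *)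

theory Defs
  imports "HOL-Analysis.Analysis" "HOL-Library.Lattice_Algebras"
begin

class banach_lattice = banach + ordered_real_vector + lattice_ab_group_add_abs +
  assumes norm_mono_abs: "\<bar>x\<bar> \<le> \<bar>y\<bar> \<Longrightarrow> norm x \<le> norm y"

instance real :: banach_lattice
  by standard (auto simp: sup_real_def)

lemma norm_abs_banach_lattice [simp]: "norm \<bar>x :: 'a::banach_lattice\<bar> = norm x"
  by (intro order.antisym norm_mono_abs) simp_all

lemma two_sup_eq:
  fixes a b :: "'a::lattice_ab_group_add_abs"
  shows "sup a b + sup a b = a + b + \<bar>a - b\<bar>"
proof -
  have "\<bar>a - b\<bar> = sup (a - b) (b - a)"
    by (simp add: abs_lattice)
  then have "a + b + \<bar>a - b\<bar> = sup (a + b + (a - b)) (a + b + (b - a))"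
    by (simp add: add_sup_distrib_left)
  also have "\<dots> = sup (a + a) (b + b)"
    by (simp add: algebra_simps)
  also have "\<dots> = sup a b + sup a b"
  proof -
    have "a + b \<le> sup (a + a) (b + b)"
    proof -
      let ?s = "sup (a + a) (b + b)"
      have "a + a + (b + b) \<le> ?s + ?s"
        by (intro add_mono) simp_all
      then have "0 \<le> (?s - (a + b)) + (?s - (a + b))"
        by (simp add: algebra_simps)
      then show ?thesis
        by simp
    qed
    then show ?thesis
      unfolding add_sup_distrib_left add_sup_distrib_right
      by (intro order.antisym sup_least) (auto simp: le_supI1 le_supI2 add.commute)
  qed
  finally show ?thesis ..
qed

lemma sup_eq_abs:
  fixes a b :: "'a::banach_lattice"
  shows "sup a b = (1/2) *\<^sub>R (a + b + \<bar>a - b\<bar>)"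
proof -
  have "sup a b = (1/2) *\<^sub>R (sup a b + sup a b)"
    by (simp flip: scaleR_2)
  then show ?thesis
    by (simp only: two_sup_eq)
qed

lemma lipschitz_abs_banach_lattice:
  fixes x y :: "'a::banach_lattice"
  shows "norm (\<bar>x\<bar> - \<bar>y\<bar>) \<le> norm (x - y)"
  by (rule norm_mono_abs) (rule abs_triangle_ineq3)

lemma continuous_on_abs_banach_lattice:
  fixes f :: "'a::topological_space \<Rightarrow> 'b::banach_lattice"
  assumes "continuous_on S f"
  shows "continuous_on S (\<lambda>x. \<bar>f x\<bar>)"
proof -
  have "continuous_on UNIV (abs :: 'b \<Rightarrow> 'b)"
    unfolding continuous_on_iff dist_norm
    by (meson lipschitz_abs_banach_lattice le_less_trans)
  then show ?thesis
    using assms continuous_on_compose2 by blast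
qed

lemma bcontfun_abs: "f \<in> bcontfun \<Longrightarrow> (\<lambda>x. \<bar>f x\<bar>) \<in> bcontfun"
  for f :: "'a::topological_space \<Rightarrow> 'b::banach_lattice"
  by (auto simp: bcontfun_def bounded_iff intro: continuous_on_abs_banach_lattice)

lemma bcontfun_sup: "f \<in> bcontfun \<Longrightarrow> g \<in> bcontfun \<Longrightarrow> (\<lambda>x. sup (f x) (g x)) \<in> bcontfun"
  for f g :: "'a::topological_space \<Rightarrow> 'b::banach_lattice"
  unfolding sup_eq_abs
  by (intro scaleR_cont plus_cont minus_cont bcontfun_abs)

lemma bcontfun_inf: "f \<in> bcontfun \<Longrightarrow> g \<in> bcontfun \<Longrightarrow> (\<lambda>x. inf (f x) (g x)) \<in> bcontfun"
  for f g :: "'a::topological_space \<Rightarrow> 'b::banach_lattice"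
  unfolding inf_eq_neg_sup
  by (intro uminus_cont bcontfun_sup)

text \<open>The library proves completeness only for metric domains; the argument does not use the metric,
  and \<open>nat\<close> carries no metric in the library.\<close>

instance bcontfun :: (topological_space, complete_space) complete_space
proof
  fix f :: "nat \<Rightarrow> ('a, 'b) bcontfun"
  assume "Cauchy f"
  then obtain g where "uniform_limit UNIV f g sequentially"
    using uniformly_convergent_eq_cauchy[of "\<lambda>_. True" f]
    unfolding Cauchy_def uniform_limit_sequentially_iff
    by (metis dist_fun_lt_imp_dist_val_lt)
  from uniform_limit_bcontfunE[OF this sequentially_bot]
  obtain l' where "g = apply_bcontfun l'" "f \<longlonglongrightarrow> l'"
    by metis
  then show "convergent f"
    by (intro convergentI)
qed

instance bcontfun :: (topological_space, banach) banach ..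

text \<open>Bounded continuous functions with values in a Banach lattice, under the pointwise order.\<close>

unbundle bcontfun.lifting

instantiation bcontfun :: (topological_space, banach_lattice) banach_lattice
begin

lift_definition less_eq_bcontfun :: "'a \<Rightarrow>\<^sub>C 'b \<Rightarrow> 'a \<Rightarrow>\<^sub>C 'b \<Rightarrow> bool"
  is "\<lambda>f g. \<forall>x. f x \<le> g x" .

definition less_bcontfun :: "'a \<Rightarrow>\<^sub>C 'b \<Rightarrow> 'a \<Rightarrow>\<^sub>C 'b \<Rightarrow> bool"
  where "less_bcontfun f g \<longleftrightarrow> f \<le> g \<and> \<not> g \<le> f"

lift_definition sup_bcontfun :: "'a \<Rightarrow>\<^sub>C 'b \<Rightarrow> 'a \<Rightarrow>\<^sub>C 'b \<Rightarrow> 'a \<Rightarrow>\<^sub>C 'b"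
  is "\<lambda>f g x. sup (f x) (g x)"
  by (rule bcontfun_sup)

lift_definition inf_bcontfun :: "'a \<Rightarrow>\<^sub>C 'b \<Rightarrow> 'a \<Rightarrow>\<^sub>C 'b \<Rightarrow> 'a \<Rightarrow>\<^sub>C 'b"
  is "\<lambda>f g x. inf (f x) (g x)"
  by (rule bcontfun_inf)

lift_definition abs_bcontfun :: "'a \<Rightarrow>\<^sub>C 'b \<Rightarrow> 'a \<Rightarrow>\<^sub>C 'b"
  is "\<lambda>f x. \<bar>f x\<bar>"
  by (rule bcontfun_abs)

instance
proof
  fix f g h :: "'a \<Rightarrow>\<^sub>C 'b" and a b :: real
  show "f < g \<longleftrightarrow> f \<le> g \<and> \<not> g \<le> f"
    by (rule less_bcontfun_def)
  show "f \<le> f"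
    by transfer simp
  show "f \<le> h" if "f \<le> g" "g \<le> h"
    using that by transfer (blast intro: order_trans)
  show "f = g" if "f \<le> g" "g \<le> f"
    using that by transfer (auto intro: order.antisym)
  show "inf f g \<le> f" "inf f g \<le> g" "f \<le> sup f g" "g \<le> sup f g"
    by (transfer, simp)+
  show "f \<le> inf g h" if "f \<le> g" "f \<le> h"
    using that by transfer simp
  show "sup g h \<le> f" if "g \<le> f" "h \<le> f"
    using that by transfer simp
  show "h + f \<le> h + g" if "f \<le> g"
    using that by transfer simp
  show "a *\<^sub>R f \<le> a *\<^sub>R g" if "f \<le> g" "0 \<le> a"
    using that by transfer (simp add: scaleR_left_mono)
  show "a *\<^sub>R f \<le> b *\<^sub>R f" if "a \<le> b" "0 \<le> f"
    using that by transfer (simp add: scaleR_right_mono)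
  show "\<bar>f\<bar> = sup f (- f)"
    by transfer (simp add: abs_lattice)
  show "norm f \<le> norm g" if "\<bar>f\<bar> \<le> \<bar>g\<bar>"
  proof (rule norm_bound)
    fix x
    have "norm (f x) \<le> norm (g x)"
      using that by (intro norm_mono_abs) (transfer, simp)
    also have "\<dots> \<le> norm g"
      by (rule norm_bounded)
    finally show "norm (f x) \<le> norm g" .
  qed
qed

end

text \<open>Every function on the discrete space \<open>nat\<close> is continuous, so this is the space of
  all bounded real sequences with the supremum norm and the coordinatewise order.\<close>

type_synonym l_infinity = "nat \<Rightarrow>\<^sub>C real"

definition disjoint_seq :: "(nat \<Rightarrow> 'a::banach_lattice) \<Rightarrow> bool" where
  "disjoint_seq x \<longleftrightarrow> (\<forall>n m. n \<noteq> m \<longrightarrow> inf \<bar>x n\<bar> \<bar>x m\<bar> = 0)"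

definition solid_hull :: "'a::banach_lattice set \<Rightarrow> 'a set" where
  "solid_hull A = {x. \<exists>a\<in>A. \<bar>x\<bar> \<le> \<bar>a\<bar>}"

definition weakly_converges_to :: "(nat \<Rightarrow> 'a::real_normed_vector) \<Rightarrow> 'a \<Rightarrow> bool" where
  "weakly_converges_to x l \<longleftrightarrow>
    (\<forall>\<phi> :: 'a \<Rightarrow> real. bounded_linear \<phi> \<longrightarrow> (\<lambda>n. \<phi> (x n)) \<longlonglongrightarrow> \<phi> l)"

definition disjointly_weakly_compact_set :: "'a::banach_lattice set \<Rightarrow> bool" where
  "disjointly_weakly_compact_set A \<longleftrightarrow> bounded A \<and>
    (\<forall>x. disjoint_seq x \<and> range x \<subseteq> solid_hull A \<longrightarrow> weakly_converges_to x 0)"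

definition disjointly_weakly_compact :: "('a::banach \<Rightarrow> 'b::banach_lattice) \<Rightarrow> bool" where
  "disjointly_weakly_compact T \<longleftrightarrow>
    bounded_linear T \<and> disjointly_weakly_compact_set (T ` cball 0 1)"

definition M_weakly_compact :: "('a::banach_lattice \<Rightarrow> 'b::banach) \<Rightarrow> bool" where
  "M_weakly_compact T \<longleftrightarrow> bounded_linear T \<and>
    (\<forall>x. bounded (range x) \<and> disjoint_seq x \<longrightarrow> (\<lambda>n. norm (T (x n))) \<longlonglongrightarrow> 0)"

definition positive_operator :: "('a::banach_lattice \<Rightarrow> 'b::banach_lattice) \<Rightarrow> bool" where
  "positive_operator T \<longleftrightarrow> linear T \<and> (\<forall>x. 0 \<le> x \<longrightarrow> 0 \<le> T x)"

end

theory Submission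
  imports Defs
begin

text \<open>A disjoint sequence \<open>y\<^sub>n\<close> in the unit ball of \<open>\<ell>\<^sub>\<infinity>\<close> satisfies \<open>\<parallel>\<Sum>\<^sub>n \<epsilon>\<^sub>n y\<^sub>n\<parallel> \<le> 1\<close> for all
  signs, hence is weakly null, so every bounded operator into \<open>\<ell>\<^sub>\<infinity>\<close> is disjointly weakly compact.
  An infinite-dimensional Banach lattice contains a disjoint sequence of positive unit vectors \<open>e\<^sub>n\<close>;
  choosing positive functionals \<open>f\<^sub>n\<close> of norm one with \<open>f\<^sub>n e\<^sub>n = 1\<close>, the positive operator
  \<open>x \<mapsto> (f\<^sub>n x)\<^sub>n\<close> is not M-weakly compact. In finite dimension a disjoint sequence has only finitely
  many nonzero terms, since disjoint nonzero vectors are linearly independent.\<close>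

section \<open>Disjoint vectors, linear independence and the finite-dimensional direction\<close>

text \<open>Expanded by distributivity, the right side is the infimum of \<open>a + b\<close>,
  \<open>a + c\<close>, \<open>c + b\<close> and \<open>c + c\<close>, and the left side lies below
  each of the four.\<close>

lemma inf_add_le:
  fixes a b c :: "'a::lattice_ab_group_add_abs"
  assumes "0 \<le> a" "0 \<le> b" "0 \<le> c"
  shows "inf (a + b) c \<le> inf a c + inf b c"
proof -
  have "inf (a + b) c \<le> a + c" "inf (a + b) c \<le> c + b" "inf (a + b) c \<le> c + c"
    using assms by (metis inf.coboundedI2 le_add_same_cancel1 le_add_same_cancel2)+
  then show ?thesis
    by (simp add: add_inf_distrib_left add_inf_distrib_right le_infI)
qed

text \<open>The positive part of \<open>z\<close> is \<open>z\<close> plus the negative part.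
  Pulling the negative part out of the infimum leaves \<open>inf z 0\<close>, which is its
  opposite.\<close>

lemma inf_sup_neg_eq_0:
  fixes z :: "'a::lattice_ab_group_add_abs"
  shows "inf (sup z 0) (sup (- z) 0) = 0"
proof -
  have "sup z 0 = z + sup (- z) 0"
    by (simp add: add_sup_distrib_left sup_commute)
  then have "inf (sup z 0) (sup (- z) 0) = inf z 0 + sup (- z) 0"
    by (simp add: add_inf_distrib_right)
  also have "\<dots> = inf z 0 + - inf z 0"
    by (simp add: neg_inf_eq_sup)
  finally show ?thesis
    by (simp only: add.right_inverse)
qed

lemma inf_eq_0_mono:
  fixes a b c d :: "'a::lattice_ab_group_add_abs"
  assumes "inf c d = 0" "0 \<le> a" "a \<le> c" "0 \<le> b" "b \<le> d"
  shows "inf a b = 0"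
proof (rule order.antisym)
  show "inf a b \<le> 0"
    using assms inf_mono[of a c b d] by simp
qed (use assms in simp)

lemma abs_scaleR_le:
  fixes x :: "'a::banach_lattice"
  shows "\<bar>c *\<^sub>R x\<bar> \<le> \<bar>c\<bar> *\<^sub>R \<bar>x\<bar>"
proof -
  have *: "r *\<^sub>R y \<le> \<bar>r\<bar> *\<^sub>R \<bar>y\<bar>" for r and y :: 'a
  proof (cases "0 \<le> r")
    case True
    then show ?thesis by (auto intro: scaleR_left_mono abs_ge_self)
  next
    case False
    then have "(- r) *\<^sub>R (- y) \<le> (- r) *\<^sub>R \<bar>y\<bar>"
      by (intro scaleR_left_mono) (auto intro: abs_ge_minus_self)
    with False show ?thesis by simp
  qed
  from *[of c x] *[of "- c" x] show ?thesis
    by (intro abs_leI) auto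
qed

lemma inf_scaleR_le:
  fixes a b :: "'a::banach_lattice"
  assumes "0 < c"
  shows "inf (c *\<^sub>R a) (c *\<^sub>R b) \<le> c *\<^sub>R inf a b"
proof -
  let ?w = "inf (c *\<^sub>R a) (c *\<^sub>R b)"
  have "inverse c *\<^sub>R ?w \<le> inverse c *\<^sub>R (c *\<^sub>R a)" "inverse c *\<^sub>R ?w \<le> inverse c *\<^sub>R (c *\<^sub>R b)"
    using assms by (intro scaleR_left_mono; simp)+
  then have "inverse c *\<^sub>R ?w \<le> inf a b"
    using assms by simp
  then have "c *\<^sub>R (inverse c *\<^sub>R ?w) \<le> c *\<^sub>R inf a b"
    using assms by (intro scaleR_left_mono) auto
  then show ?thesis
    using assms by simp
qed

text \<open>The factor \<open>c + 1\<close> is positive and dominates both \<open>c\<close> and 1.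
  Scaling both vectors by it preserves disjointness, and the results lie above
  \<open>c *\<^sub>R a\<close> and \<open>b\<close>.\<close>

lemma inf_scaleR_eq_0:
  fixes a b :: "'a::banach_lattice"
  assumes "inf a b = 0" "0 \<le> c"
  shows "inf (c *\<^sub>R a) b = 0"
proof -
  have ab: "0 \<le> a" "0 \<le> b"
    using assms by (metis inf.cobounded1 inf.cobounded2)+
  have "inf ((c + 1) *\<^sub>R a) ((c + 1) *\<^sub>R b) \<le> (c + 1) *\<^sub>R inf a b"
    using assms by (intro inf_scaleR_le) auto
  then have "inf ((c + 1) *\<^sub>R a) ((c + 1) *\<^sub>R b) = 0"
    using assms ab by (intro order.antisym) (auto intro: scaleR_nonneg_nonneg)
  moreover have "c *\<^sub>R a \<le> (c + 1) *\<^sub>R a" "b \<le> (c + 1) *\<^sub>R b"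
    using ab assms scaleR_right_mono[of c "c + 1" a] scaleR_right_mono[of 1 "c + 1" b] by auto
  ultimately show ?thesis
    using ab assms by (metis inf_eq_0_mono scaleR_nonneg_nonneg)
qed

lemma subspace_disjoint_complement:
  fixes x :: "'a::banach_lattice"
  shows "subspace {y. inf \<bar>y\<bar> \<bar>x\<bar> = 0}"
proof (rule subspaceI)
  show "0 \<in> {y. inf \<bar>y\<bar> \<bar>x\<bar> = 0}"
    by (simp add: inf_absorb1)
next
  fix y z assume "y \<in> {y. inf \<bar>y\<bar> \<bar>x\<bar> = 0}" "z \<in> {y. inf \<bar>y\<bar> \<bar>x\<bar> = 0}"
  then have "inf (\<bar>y\<bar> + \<bar>z\<bar>) \<bar>x\<bar> = 0"
    using inf_add_le[of "\<bar>y\<bar>" "\<bar>z\<bar>" "\<bar>x\<bar>"] by (intro order.antisym) auto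
  then show "y + z \<in> {y. inf \<bar>y\<bar> \<bar>x\<bar> = 0}"
    using inf_eq_0_mono[of "\<bar>y\<bar> + \<bar>z\<bar>" "\<bar>x\<bar>" "\<bar>y + z\<bar>" "\<bar>x\<bar>"] by (simp add: abs_triangle_ineq)
next
  fix c :: real and y assume "y \<in> {y. inf \<bar>y\<bar> \<bar>x\<bar> = 0}"
  then have "inf (\<bar>c\<bar> *\<^sub>R \<bar>y\<bar>) \<bar>x\<bar> = 0"
    by (intro inf_scaleR_eq_0) auto
  then show "c *\<^sub>R y \<in> {y. inf \<bar>y\<bar> \<bar>x\<bar> = 0}"
    using inf_eq_0_mono[of "\<bar>c\<bar> *\<^sub>R \<bar>y\<bar>" "\<bar>x\<bar>" "\<bar>c *\<^sub>R y\<bar>" "\<bar>x\<bar>"] by (simp add: abs_scaleR_le)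
qed

text \<open>The disjoint complement of a vector is a subspace. If it contains the other vectors it
  contains their span, so a dependent vector is disjoint from itself and vanishes.\<close>

lemma independent_disjoint:
  fixes S :: "'a::banach_lattice set"
  assumes "pairwise (\<lambda>x y. inf \<bar>x\<bar> \<bar>y\<bar> = 0) S" "0 \<notin> S"
  shows "independent S"
proof
  assume "dependent S"
  then obtain a where a: "a \<in> S" "a \<in> span (S - {a})"
    by (auto simp: dependent_def)
  have "span (S - {a}) \<subseteq> {y. inf \<bar>y\<bar> \<bar>a\<bar> = 0}"
    using assms a by (intro span_minimal subspace_disjoint_complement) (auto simp: pairwise_def)
  with a have "\<bar>a\<bar> = 0"
    by auto
  with a assms show False
    by simp
qed

lemma finite_disjoint_seq_nonzero:
  fixes x :: "nat \<Rightarrow> 'a::banach_lattice"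
  assumes "finite B" "span B = (UNIV :: 'a set)" "disjoint_seq x"
  shows "finite {n. x n \<noteq> 0}"
proof -
  let ?N = "{n. x n \<noteq> 0}"
  have disj: "inf \<bar>x n\<bar> \<bar>x m\<bar> = 0" if "n \<noteq> m" for n m
    using assms(3) that by (simp add: disjoint_seq_def)
  have "pairwise (\<lambda>a b. inf \<bar>a\<bar> \<bar>b\<bar> = 0) (x ` ?N)"
    unfolding pairwise_image by (auto simp: pairwise_def intro: disj)
  then have "independent (x ` ?N)"
    by (intro independent_disjoint) auto
  then have "finite (x ` ?N)"
    using independent_span_bound[OF assms(1), of "x ` ?N"] assms(2) by simp
  \<comment> \<open>This passes from finitely many values to finitely many indices: a repeated value
    would be disjoint from itself, hence zero.\<close>
  moreover have "inj_on x ?N"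
  proof (rule inj_onI, rule ccontr)
    fix n m assume "n \<in> ?N" "x n = x m" "n \<noteq> m"
    with disj[of n m] show False by simp
  qed
  ultimately show ?thesis
    using finite_imageD by blast
qed

lemma M_weakly_compact_finite_dim:
  fixes T :: "'a::banach_lattice \<Rightarrow> 'b::banach"
  assumes "finite B" "span B = (UNIV :: 'a set)" "bounded_linear T"
  shows "M_weakly_compact T"
  unfolding M_weakly_compact_def
proof (intro conjI allI impI assms)
  interpret T: bounded_linear T by fact
  fix x :: "nat \<Rightarrow> 'a" assume "bounded (range x) \<and> disjoint_seq x"
  then have "finite {n. x n \<noteq> 0}"
    using assms finite_disjoint_seq_nonzero by blast
  \<comment> \<open>On the naturals, holding off a finite set is the same as holding
    eventually.\<close>
  then have "eventually (\<lambda>n. norm (T (x n)) = 0) sequentially"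
    unfolding cofinite_eq_sequentially[symmetric] eventually_cofinite
    by (rule rev_finite_subset) (auto simp: T.zero)
  then show "(\<lambda>n. norm (T (x n))) \<longlonglongrightarrow> 0"
    by (rule tendsto_eventually)
qed

section \<open>Weak convergence of disjoint sequences in \<open>l_infinity\<close>\<close>

lemma l_infinity_disjoint_imp_weakly_null:
  fixes y :: "nat \<Rightarrow> l_infinity"
  assumes "bounded (range y)" "disjoint_seq y"
  shows "weakly_converges_to y 0"
  unfolding weakly_converges_to_def
proof (intro allI impI)
  fix \<phi> :: "l_infinity \<Rightarrow> real"
  assume "bounded_linear \<phi>"
  then interpret bounded_linear \<phi> .
  obtain K where K: "0 < K" "\<And>v. norm (\<phi> v) \<le> norm v * K"
    using pos_bounded by blast
  obtain C where C: "0 < C" "\<And>n. norm (y n) \<le> C"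
    using assms by (auto simp: bounded_pos)
  have disj: "y n k = 0 \<or> y m k = 0" if "n \<noteq> m" for n m k
  proof -
    have "apply_bcontfun (inf \<bar>y n\<bar> \<bar>y m\<bar>) k = 0"
      using assms that by (simp add: disjoint_seq_def)
    then show ?thesis
      by (auto simp: inf_bcontfun.rep_eq abs_bcontfun.rep_eq inf_min min_def split: if_splits)
  qed
  have "(\<Sum>n<N. \<bar>\<phi> (y n)\<bar>) \<le> C * K" for N
  proof -
    \<comment> \<open>The signs turn \<open>\<phi> ?s\<close> into the sum of the absolute values,
      while disjointness keeps the norm of \<open>?s\<close> below \<open>C\<close>.\<close>
    let ?s = "\<Sum>n<N. sgn (\<phi> (y n)) *\<^sub>R y n"
    have app: "apply_bcontfun (\<Sum>n<M. f n) k = (\<Sum>n<M. apply_bcontfun (f n) k)"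
      for k M and f :: "nat \<Rightarrow> l_infinity"
      by (induction M) auto
    have "norm ?s \<le> C"
    proof (rule norm_bound)
      fix k
      show "norm (?s k) \<le> C"
      \<comment> \<open>At each coordinate at most one \<open>y m\<close> is nonzero, so the sum
        collapses to a single term or to 0.\<close>
      proof (cases "\<exists>m<N. y m k \<noteq> 0")
        case True
        then obtain m where m: "m < N" "y m k \<noteq> 0" by blast
        have "?s k = (\<Sum>n<N. if n = m then sgn (\<phi> (y m)) * y m k else 0)"
          unfolding app using disj m by (intro sum.cong) auto
        also have "\<dots> = sgn (\<phi> (y m)) * y m k"
          using m by simp
        finally have "norm (?s k) \<le> norm (y m k)"
          by (auto simp: sgn_real_def)
        also have "\<dots> \<le> C"
          using C(2) norm_bounded order_trans by blast
        finally show ?thesis .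
      next
        case False
        then show ?thesis
          unfolding app using C(1) by (simp add: sum.neutral)
      qed
    qed
    then have "norm (\<phi> ?s) \<le> C * K"
      using K by (meson mult_right_mono less_imp_le order_trans)
    moreover have "\<phi> ?s = (\<Sum>n<N. \<bar>\<phi> (y n)\<bar>)"
      by (simp add: sum scaleR mult.commute linordered_idom_class.abs_sgn)
    ultimately show ?thesis by simp
  qed
  then have "summable (\<lambda>n. \<bar>\<phi> (y n)\<bar>)"
    by (intro bounded_imp_summable[where B="C * K"]) (auto simp: lessThan_Suc_atMost[symmetric] simp del: sum.lessThan_Suc)
  then have "(\<lambda>n. \<bar>\<phi> (y n)\<bar>) \<longlonglongrightarrow> 0"
    by (rule summable_LIMSEQ_zero)
  then show "(\<lambda>n. \<phi> (y n)) \<longlonglongrightarrow> \<phi> 0"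
    by (simp add: zero tendsto_rabs_zero_iff)
qed

lemma l_infinity_disjointly_weakly_compact:
  fixes T :: "'a::banach \<Rightarrow> l_infinity"
  assumes "bounded_linear T"
  shows "disjointly_weakly_compact T"
proof -
  have bdd: "bounded (T ` cball 0 1)"
    using assms by (intro bounded_linear_image) auto
  moreover have "weakly_converges_to x 0"
    if x: "disjoint_seq x" "range x \<subseteq> solid_hull (T ` cball 0 1)" for x
  proof (rule l_infinity_disjoint_imp_weakly_null)
    obtain C where "\<And>v. v \<in> T ` cball 0 1 \<Longrightarrow> norm v \<le> C"
      using bdd by (auto simp: bounded_iff)
    \<comment> \<open>The norm is monotone in the modulus, so the solid hull obeys the same bound as
      the image.\<close>
    then have "norm v \<le> C" if "v \<in> solid_hull (T ` cball 0 1)" for v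
      using that unfolding solid_hull_def by (blast intro: order_trans norm_mono_abs)
    then show "bounded (range x)"
      using x unfolding bounded_iff by blast
  qed (fact x)
  ultimately show ?thesis
    using assms by (auto simp: disjointly_weakly_compact_def disjointly_weakly_compact_set_def)
qed

section \<open>Sublinear functionals, the Hahn-Banach theorem and positive norming
  functionals\<close>

text \<open>Homogeneity is stated as an inequality for positive scalars, which is easy to check for
  infima; \<open>sublinear_0\<close> and \<open>sublinear_scaleR\<close> recover the
  equality.\<close>

definition sublinear :: "('a::real_vector \<Rightarrow> real) \<Rightarrow> bool" where
  "sublinear q \<longleftrightarrow> (\<forall>x y. q (x + y) \<le> q x + q y) \<and> (\<forall>c>0. \<forall>x. q (c *\<^sub>R x) \<le> c * q x)"

lemma sublinear_add: "sublinear q \<Longrightarrow> q (x + y) \<le> q x + q y"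
  by (simp add: sublinear_def)

lemma sublinear_0: "sublinear q \<Longrightarrow> q 0 = 0"
proof -
  assume "sublinear q"
  \<comment> \<open>The factor 2 gives \<open>0 \<le> q 0\<close> and the factor 1/2 gives
    \<open>q 0 \<le> 0\<close>.\<close>
  then have "q (2 *\<^sub>R 0) \<le> 2 * q 0" "q ((1/2) *\<^sub>R 0) \<le> (1/2) * q 0"
    unfolding sublinear_def by (metis zero_less_numeral, metis half_gt_zero_iff zero_less_one)
  then show ?thesis by simp
qed

lemma sublinear_scaleR:
  assumes "sublinear q" "0 \<le> c"
  shows "q (c *\<^sub>R x) = c * q x"
proof (cases "c = 0")
  case True
  then show ?thesis using assms by (simp add: sublinear_0)
next
  case False
  then have c: "0 < c" using assms by simp
  have "q (c *\<^sub>R x) \<le> c * q x"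
    using assms c by (simp add: sublinear_def)
  moreover have "q (inverse c *\<^sub>R (c *\<^sub>R x)) \<le> inverse c * q (c *\<^sub>R x)"
    using assms c unfolding sublinear_def by (metis positive_imp_inverse_positive)
  ultimately show ?thesis
    using c by (simp add: field_simps)
qed

text \<open>The index \<open>k\<close> may depend on the vectors. This covers both uses: shifts
  along a ray, where indices add and scale, and chains of functionals, where the smaller of two is
  taken.\<close>

lemma sublinear_INF:
  fixes g :: "'i \<Rightarrow> 'a::real_vector \<Rightarrow> real"
  assumes ne: "I \<noteq> {}" and bdd: "\<And>x. bdd_below ((\<lambda>i. g i x) ` I)"
    and add: "\<And>i j x y. i \<in> I \<Longrightarrow> j \<in> I \<Longrightarrow> \<exists>k\<in>I. g k (x + y) \<le> g i x + g j y"
    and scale: "\<And>i c x. i \<in> I \<Longrightarrow> 0 < c \<Longrightarrow> \<exists>k\<in>I. g k (c *\<^sub>R x) \<le> c * g i x"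
  shows "sublinear (\<lambda>x. INF i\<in>I. g i x)"
  unfolding sublinear_def
proof (intro conjI allI impI)
  fix x y
  have *: "(INF i\<in>I. g i (x + y)) \<le> g i x + g j y" if "i \<in> I" "j \<in> I" for i j
    using add[OF that] bdd by (meson cINF_lower order_trans)
  have "(INF i\<in>I. g i (x + y)) - g j y \<le> (INF i\<in>I. g i x)" if "j \<in> I" for j
    using * that by (intro cINF_greatest ne) (simp add: diff_le_eq)
  then have "(INF i\<in>I. g i (x + y)) - (INF i\<in>I. g i x) \<le> (INF i\<in>I. g i y)"
    by (intro cINF_greatest ne) (simp add: algebra_simps)
  then show "(INF i\<in>I. g i (x + y)) \<le> (INF i\<in>I. g i x) + (INF i\<in>I. g i y)"
    by simp
next
  fix c :: real and x assume c: "0 < c"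
  have "(INF i\<in>I. g i (c *\<^sub>R x)) \<le> c * g i x" if "i \<in> I" for i
    using scale[OF that c] bdd by (meson cINF_lower order_trans)
  then have "(INF i\<in>I. g i (c *\<^sub>R x)) / c \<le> (INF i\<in>I. g i x)"
    using c by (intro cINF_greatest ne) (simp add: field_simps)
  then show "(INF i\<in>I. g i (c *\<^sub>R x)) \<le> c * (INF i\<in>I. g i x)"
    using c by (simp add: field_simps)
qed

text \<open>The witness is the infimum over \<open>t \<ge> 0\<close> of
  \<open>q (x + t *\<^sub>R y) - t * q y\<close>; \<open>t = 0\<close> gives
  \<open>s \<le> q\<close> and \<open>t = 1\<close> gives the bound at \<open>- y\<close>. Applied
  to a minimal \<open>q\<close>, this yields oddness.\<close>

lemma sublinear_decrease_at:
  fixes q :: "'a::real_vector \<Rightarrow> real"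
  assumes q: "sublinear q"
  obtains s where "sublinear s" "s \<le> q" "s (- y) \<le> - q y"
proof
  let ?g = "\<lambda>t x. q (x + t *\<^sub>R y) - t * q y"
  let ?s = "\<lambda>x. INF t\<in>{0..}. ?g t x"
  have bdd: "bdd_below ((\<lambda>t. ?g t x) ` {0..})" for x
  proof (rule bdd_belowI2)
    fix t :: real assume "t \<in> {0..}"
    \<comment> \<open>Subadditivity is applied to \<open>t *\<^sub>R y\<close> written as
      \<open>x + t *\<^sub>R y\<close> plus \<open>- x\<close>.\<close>
    then show "- q (- x) \<le> ?g t x"
      using sublinear_add[OF q, of "x + t *\<^sub>R y" "- x"] sublinear_scaleR[OF q, of t y] by simp
  qed
  show "sublinear ?s"
  proof (rule sublinear_INF[OF _ bdd])
    fix t t' :: real and x x' assume "t \<in> {0..}" "t' \<in> {0..}"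
    then show "\<exists>k\<in>{0..}. ?g k (x + x') \<le> ?g t x + ?g t' x'"
      using sublinear_add[OF q, of "x + t *\<^sub>R y" "x' + t' *\<^sub>R y"]
      by (intro bexI[of _ "t + t'"]) (auto simp: algebra_simps)
  next
    fix t c :: real and x assume "t \<in> {0..}" "0 < c"
    then show "\<exists>k\<in>{0..}. ?g k (c *\<^sub>R x) \<le> c * ?g t x"
      using sublinear_scaleR[OF q, of c "x + t *\<^sub>R y"]
      by (intro bexI[of _ "c * t"]) (auto simp: algebra_simps)
  qed simp
  show "?s \<le> q"
  proof (rule le_funI)
    fix x
    show "?s x \<le> q x"
      using cINF_lower[OF bdd, of 0 x] by simp
  qed
  show "?s (- y) \<le> - q y"
    using cINF_lower[OF bdd, of 1 "- y"] sublinear_0[OF q] by simp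
qed

lemma sublinear_minimal_exists:
  fixes p :: "'a::real_vector \<Rightarrow> real"
  assumes p: "sublinear p"
  obtains m where "sublinear m" "m \<le> p" "\<And>q. sublinear q \<Longrightarrow> q \<le> m \<Longrightarrow> q = m"
proof -
  let ?A = "{q. sublinear q \<and> q \<le> p}"
  have "\<exists>m\<in>?A. \<forall>q\<in>?A. q \<le> m \<longrightarrow> q = m"
  \<comment> \<open>The order is reversed: the upper bound of a chain is its pointwise infimum, and
    a maximal element is a minimal functional.\<close>
  proof (rule predicate_Zorn)
    show "partial_order_on ?A (relation_of (\<lambda>q r. r \<le> q) ?A)"
      by (rule partial_order_on_relation_ofI) auto
    fix C assume "C \<in> Chains (relation_of (\<lambda>q r. r \<le> q) ?A)"
    then have sub: "\<And>q. q \<in> C \<Longrightarrow> sublinear q \<and> q \<le> p"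
      and tot: "\<And>q r. q \<in> C \<Longrightarrow> r \<in> C \<Longrightarrow> q \<le> r \<or> r \<le> q"
      by (auto simp: Chains_def relation_of_def)
    show "\<exists>u\<in>?A. \<forall>q\<in>C. u \<le> q"
    proof (cases "C = {}")
      case True
      with p show ?thesis by auto
    next
      case False
      let ?u = "\<lambda>x. INF q\<in>C. q x"
      \<comment> \<open>Since \<open>0 = q 0 \<le> q x + q (- x)\<close>, the common majorant
        \<open>p\<close> also bounds the chain from below.\<close>
      have bdd: "bdd_below ((\<lambda>q. q x) ` C)" for x
      proof (rule bdd_belowI2)
        fix q assume "q \<in> C"
        then have "sublinear q" "q (- x) \<le> p (- x)"
          using sub by (auto simp: le_fun_def)
        then show "- p (- x) \<le> q x"
          using sublinear_add[of q x "- x"] sublinear_0[of q] by simp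
      qed
      have "sublinear ?u"
      proof (rule sublinear_INF[OF False bdd])
        fix q r x y assume qr: "q \<in> C" "r \<in> C"
        from tot[OF qr] show "\<exists>k\<in>C. k (x + y) \<le> q x + r y"
        proof
          assume "q \<le> r"
          then have "q (x + y) \<le> q x + r y"
            using sublinear_add[of q x y] sub qr by (smt (verit) le_funD)
          with qr show ?thesis by blast
        next
          assume "r \<le> q"
          then have "r (x + y) \<le> q x + r y"
            using sublinear_add[of r x y] sub qr by (smt (verit) le_funD)
          with qr show ?thesis by blast
        qed
      next
        fix q and c :: real and x assume "q \<in> C" "0 < c"
        then show "\<exists>k\<in>C. k (c *\<^sub>R x) \<le> c * q x"
          using sub by (auto simp: sublinear_def)
      qed
      moreover have lower: "?u \<le> q" if "q \<in> C" for q
        using that cINF_lower[OF bdd] by (auto simp: le_fun_def)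
      moreover have "?u \<le> p"
        using False lower sub by (meson equals0I order_trans)
      ultimately show ?thesis by blast
    qed
  qed
  then obtain m where m: "m \<in> ?A" "\<forall>q\<in>?A. q \<le> m \<longrightarrow> q = m"
    by blast
  show ?thesis
  proof
    show "q = m" if "sublinear q" "q \<le> m" for q
      using m that by (metis (mono_tags, lifting) mem_Collect_eq order_trans)
  qed (use m in auto)
qed

text \<open>A minimal sublinear functional is linear. Lowering \<open>p\<close> first at \<open>- x\<^sub>0\<close> forces
  every linear minorant to agree with \<open>p\<close> at \<open>x\<^sub>0\<close>.\<close>

theorem Hahn_Banach_sublinear:
  fixes p :: "'a::real_vector \<Rightarrow> real"
  assumes p: "sublinear p"
  obtains f where "linear f" "\<And>x. f x \<le> p x" "f x\<^sub>0 = p x\<^sub>0"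
proof -
  obtain s where s: "sublinear s" "s \<le> p" "s (- x\<^sub>0) \<le> - p x\<^sub>0"
    using sublinear_decrease_at[OF p] .
  obtain m where m: "sublinear m" "m \<le> s" "\<And>q. sublinear q \<Longrightarrow> q \<le> m \<Longrightarrow> q = m"
    using sublinear_minimal_exists[OF s(1)] by blast
  \<comment> \<open>Minimality makes the lowered functional equal to \<open>m\<close>, so its bound
    at \<open>- y\<close> holds for \<open>m\<close>.\<close>
  have neg: "m (- y) = - m y" for y
  proof -
    obtain r where "sublinear r" "r \<le> m" "r (- y) \<le> - m y"
      using sublinear_decrease_at[OF m(1)] .
    then have "m (- y) \<le> - m y"
      using m(3) by blast
    then show ?thesis
      using sublinear_add[OF m(1), of y "- y"] sublinear_0[OF m(1)] by simp
  qed
  have "linear m"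
  proof (rule linearI)
    fix x y
    show "m (x + y) = m x + m y"
      using sublinear_add[OF m(1), of x y] sublinear_add[OF m(1), of "x + y" "- y"] by (simp add: neg)
  next
    fix c :: real and x
    show "m (c *\<^sub>R x) = c *\<^sub>R m x"
      using sublinear_scaleR[OF m(1), of c x] sublinear_scaleR[OF m(1), of "- c" x]
      by (cases "0 \<le> c") (auto simp: neg)
  qed
  moreover have le: "m x \<le> p x" for x
    using m(2) s(2) by (meson le_funD order_trans)
  \<comment> \<open>By oddness \<open>m x\<^sub>0 = - m (- x\<^sub>0)\<close>, which is at least
    \<open>- s (- x\<^sub>0)\<close> and hence at least \<open>p x\<^sub>0\<close>.\<close>
  moreover have "m x\<^sub>0 = p x\<^sub>0"
    using le[of x\<^sub>0] neg[of x\<^sub>0] le_funD[OF m(2), of "- x\<^sub>0"] s(3) by simp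
  ultimately show ?thesis
    using that by blast
qed

text \<open>Linear functionals dominated by this sublinear functional are automatically positive.\<close>

lemma sublinear_norm_pos_part: "sublinear (\<lambda>x::'a::banach_lattice. norm (sup x 0))"
  unfolding sublinear_def
proof (intro conjI allI impI)
  have mono: "norm x \<le> norm y" if "0 \<le> x" "x \<le> y" for x y :: 'a
    using that by (intro norm_mono_abs) simp
  fix x y :: 'a
  have "sup (x + y) 0 \<le> sup x 0 + sup y 0"
    by (simp add: add_mono)
  then show "norm (sup (x + y) 0) \<le> norm (sup x 0) + norm (sup y 0)"
    by (intro order_trans[OF mono norm_triangle_ineq]) auto
  fix c :: real assume "0 < c"
  then have "sup (c *\<^sub>R x) 0 \<le> c *\<^sub>R sup x 0"
    by (auto intro: scaleR_left_mono scaleR_nonneg_nonneg)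
  then have "norm (sup (c *\<^sub>R x) 0) \<le> norm (c *\<^sub>R sup x 0)"
    by (intro mono) auto
  with \<open>0 < c\<close> show "norm (sup (c *\<^sub>R x) 0) \<le> c * norm (sup x 0)"
    by simp
qed

text \<open>Hahn-Banach is applied to the norm of the positive part. This bound vanishes at
  \<open>- x\<close> for \<open>x \<ge> 0\<close>, never exceeds the norm, and equals it at
  \<open>x\<^sub>0\<close>.\<close>

lemma positive_norming_functional:
  fixes x\<^sub>0 :: "'a::banach_lattice"
  assumes "0 \<le> x\<^sub>0"
  obtains f :: "'a \<Rightarrow> real"
  where "linear f" "\<And>x. 0 \<le> x \<Longrightarrow> 0 \<le> f x" "\<And>x. \<bar>f x\<bar> \<le> norm x" "f x\<^sub>0 = norm x\<^sub>0"
proof -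
  obtain f where f: "linear f" "\<And>x. f x \<le> norm (sup x 0)" "f x\<^sub>0 = norm (sup x\<^sub>0 0)"
    using Hahn_Banach_sublinear[OF sublinear_norm_pos_part] by blast
  have le: "f x \<le> norm x" for x
  proof -
    have "norm (sup x 0) \<le> norm x"
      by (intro norm_mono_abs) (simp add: abs_ge_self)
    with f(2)[of x] show ?thesis by simp
  qed
  show ?thesis
  proof
    show "0 \<le> f x" if "0 \<le> x" for x
      using f(2)[of "- x"] that by (simp add: linear_neg[OF f(1)] sup_absorb2)
    show "\<bar>f x\<bar> \<le> norm x" for x
      using le[of x] le[of "- x"] by (simp add: linear_neg[OF f(1)] abs_le_iff)
    show "f x\<^sub>0 = norm x\<^sub>0"
      using f(3) assms by (simp add: sup_absorb1)
  qed (fact f)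
qed

section \<open>Atoms and disjoint sequences in infinite dimension\<close>

text \<open>Phrased so that a positive vector that is not an atom splits at once: it has two
  disjoint nonzero positive vectors below it.\<close>

definition lattice_atom :: "'a::banach_lattice \<Rightarrow> bool" where
  "lattice_atom a \<longleftrightarrow> 0 < a \<and> (\<forall>u v. 0 \<le> u \<and> u \<le> a \<and> 0 \<le> v \<and> v \<le> a \<and> inf u v = 0 \<longrightarrow> u = 0 \<or> v = 0)"

lemma closed_nonneg: "closed {x::'a::banach_lattice. 0 \<le> x}"
proof -
  have "{x::'a. 0 \<le> x} = {x. \<bar>x\<bar> = x}"
    by (auto intro: abs_of_nonneg) (metis abs_ge_zero)
  moreover have "closed {x::'a. \<bar>x\<bar> = x}"
    by (intro closed_Collect_eq continuous_on_abs_banach_lattice continuous_on_id)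
  ultimately show ?thesis by simp
qed

text \<open>Subtract the largest multiple of \<open>a\<close> below \<open>x\<close>. The remainder
  dominates no positive multiple of \<open>a\<close>, and the atom property then forces its infimum
  with \<open>a\<close> to be arbitrarily small.\<close>

lemma atom_decomposition:
  fixes a x :: "'a::banach_lattice"
  assumes a: "lattice_atom a" and x: "0 \<le> x"
  obtains t where "0 \<le> t" "t *\<^sub>R a \<le> x" "inf (x - t *\<^sub>R a) a = 0"
proof -
  have a0: "0 < a" using a by (simp add: lattice_atom_def)
  then have na: "0 < norm a" by auto
  have mono: "norm x \<le> norm y" if "0 \<le> x" "x \<le> y" for x y :: 'a
    using that by (intro norm_mono_abs) simp
  define S where "S = {t. 0 \<le> t \<and> t *\<^sub>R a \<le> x}"
  have "S = {0..} \<inter> (\<lambda>t. x - t *\<^sub>R a) -` {x. 0 \<le> x}"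
    by (auto simp: S_def)
  moreover have "closed ((\<lambda>t. x - t *\<^sub>R a) -` {x. 0 \<le> x})"
    by (intro continuous_closed_vimage closed_nonneg) (auto intro!: continuous_intros)
  ultimately have "closed S"
    by (simp add: closed_Int)
  have ub: "t \<le> norm x / norm a" if "t \<in> S" for t
    using that mono[of "t *\<^sub>R a" x] a0 na
    by (auto simp: S_def field_simps intro: scaleR_nonneg_nonneg less_imp_le)
  have "0 \<in> S" using x by (simp add: S_def)
  have bdd: "bdd_above S" using ub by (auto simp: bdd_above_def)
  define t where "t = Sup S"
  \<comment> \<open>The supremum is attained because the positive cone is closed.\<close>
  have "t \<in> S"
    unfolding t_def using \<open>closed S\<close> \<open>0 \<in> S\<close> bdd by (intro closed_contains_Sup) auto
  then have t: "0 \<le> t" "t *\<^sub>R a \<le> x" by (auto simp: S_def)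
  define y where "y = x - t *\<^sub>R a"
  have y0: "0 \<le> y" using t by (simp add: y_def)
  have max: "\<not> s *\<^sub>R a \<le> y" if "0 < s" for s
  proof
    assume "s *\<^sub>R a \<le> y"
    then have "(t + s) *\<^sub>R a \<le> x"
      by (simp add: y_def scaleR_add_left algebra_simps)
    then have "t + s \<in> S" using that t by (simp add: S_def)
    then have "t + s \<le> t" unfolding t_def using bdd by (rule cSup_upper)
    with that show False by simp
  qed
  define w where "w = inf y a"
  have w: "0 \<le> w" "w \<le> y" "w \<le> a" using y0 a0 by (auto simp: w_def)
  have small: "w \<le> s *\<^sub>R a" if s: "0 < s" "s \<le> 1" for s
  proof -
    \<comment> \<open>The positive and negative parts of \<open>s *\<^sub>R a - w\<close> are
      disjoint and below \<open>a\<close>, so one vanishes. If it were the first,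
      \<open>s *\<^sub>R a\<close> would lie below the remainder \<open>y\<close>.\<close>
    let ?u = "sup (s *\<^sub>R a - w) 0" and ?v = "sup (- (s *\<^sub>R a - w)) 0"
    have sa: "0 \<le> s *\<^sub>R a" "s *\<^sub>R a \<le> a"
      using s a0 scaleR_right_mono[of s 1 a] by (auto intro: scaleR_nonneg_nonneg)
    have "s *\<^sub>R a - w \<le> s *\<^sub>R a" using w by simp
    then have "?u \<le> a" using sa a0 by (meson less_imp_le order_trans sup_least)
    moreover have "w - s *\<^sub>R a \<le> w" using sa by simp
    then have "w - s *\<^sub>R a \<le> a" using w by (meson order_trans)
    then have "?v \<le> a" using a0 by (simp add: less_imp_le)
    ultimately have "?u = 0 \<or> ?v = 0"
      using a inf_sup_neg_eq_0[of "s *\<^sub>R a - w"] unfolding lattice_atom_def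
      by (meson sup.cobounded2)
    moreover have "?u \<noteq> 0"
    proof
      assume "?u = 0"
      then have "s *\<^sub>R a - w \<le> 0" by (metis sup.cobounded1)
      then have "s *\<^sub>R a \<le> w" by simp
      with w max[OF s(1)] show False by (meson order_trans)
    qed
    ultimately have "- (s *\<^sub>R a - w) \<le> 0" by (metis sup.cobounded1)
    then show ?thesis by simp
  qed
  have "w = 0"
  proof (rule ccontr)
    assume "w \<noteq> 0"
    \<comment> \<open>Small enough that \<open>s *\<^sub>R a\<close> has norm at most half that of
      \<open>w\<close>, and capped at 1 so that \<open>small\<close> applies.\<close>
    define s where "s = min 1 (norm w / norm a / 2)"
    have s: "0 < s" "s \<le> 1"
      using \<open>w \<noteq> 0\<close> na by (auto simp: s_def)
    have "s * norm a \<le> norm w / norm a / 2 * norm a"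
      using na by (intro mult_right_mono) (auto simp: s_def)
    also have "\<dots> = norm w / 2"
      using na by simp
    also have "\<dots> < norm w"
      using \<open>w \<noteq> 0\<close> by simp
    finally have "s * norm a < norm w" .
    have "norm w \<le> norm (s *\<^sub>R a)" using w small s by (intro mono) auto
    with s \<open>s * norm a < norm w\<close> show False by simp
  qed
  with t show ?thesis
    using that[of t] by (simp add: w_def y_def)
qed

text \<open>Atoms are peeled off one at a time. The remainder only decreases, so it stays disjoint
  from the atoms already treated.\<close>

lemma finite_atoms_decomposition:
  fixes x :: "'a::banach_lattice"
  assumes "finite F" "\<And>a. a \<in> F \<Longrightarrow> lattice_atom a" "0 \<le> x"
  shows "\<exists>y. x - y \<in> span F \<and> 0 \<le> y \<and> (\<forall>a\<in>F. inf y a = 0)"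
  using assms
proof (induction F)
  case empty
  then show ?case by (intro exI[of _ x]) (auto simp: span_zero)
next
  case (insert a F)
  then obtain y where y: "x - y \<in> span F" "0 \<le> y" "\<And>b. b \<in> F \<Longrightarrow> inf y b = 0"
    by auto
  obtain t where t: "0 \<le> t" "t *\<^sub>R a \<le> y" "inf (y - t *\<^sub>R a) a = 0"
    using atom_decomposition y(2) insert.prems by blast
  have a0: "0 < a" using insert.prems by (auto simp: lattice_atom_def)
  have le: "y - t *\<^sub>R a \<le> y"
    using a0 t by (simp add: scaleR_nonneg_nonneg)
  have "inf (y - t *\<^sub>R a) b = 0" if "b \<in> F" for b
    using that y t le insert.prems
    by (intro inf_eq_0_mono[OF y(3)[OF that]]) (auto simp: lattice_atom_def less_imp_le)
  moreover have "x - (y - t *\<^sub>R a) \<in> span (insert a F)"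
  proof -
    have "(x - y) + t *\<^sub>R a \<in> span (insert a F)"
      using y(1) span_mono[of F "insert a F"] by (intro span_add span_scale span_base[of a]) auto
    then show ?thesis by (simp add: algebra_simps)
  qed
  ultimately show ?case
    using t by (intro exI[of _ "y - t *\<^sub>R a"]) auto
qed

text \<open>Keep splitting one half of the previous pair; the other halves form the sequence.\<close>

lemma disjoint_seq_below_atomless:
  fixes x :: "'a::banach_lattice"
  assumes x: "0 < x" and no_atom: "\<And>a. lattice_atom a \<Longrightarrow> \<not> a \<le> x"
  shows "\<exists>u :: nat \<Rightarrow> 'a. (\<forall>n. 0 < u n) \<and> (\<forall>n m. n \<noteq> m \<longrightarrow> inf (u n) (u m) = 0)"
proof -
  have split: "\<exists>u w. 0 < u \<and> u \<le> v \<and> 0 < w \<and> w \<le> v \<and> inf u w = 0" if "0 < v" "v \<le> x" for v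
    using no_atom[of v] that unfolding lattice_atom_def by (metis order.not_eq_order_implies_strict)
  \<comment> \<open>In each pair \<open>u\<close> is the term of the sequence and \<open>w\<close>
    is the half split at the next stage.\<close>
  have "\<exists>f. \<forall>n. (case f n of (u, w) \<Rightarrow> 0 < u \<and> 0 < w \<and> w \<le> x \<and> inf u w = 0) \<and>
      (case f n of (u, w) \<Rightarrow> case f (Suc n) of (u', w') \<Rightarrow> u' \<le> w \<and> w' \<le> w)"
  proof (rule dependent_nat_choice, goal_cases)
    case 1
    from split[OF x order_refl] show ?case by auto
  next
    case (2 p n)
    then obtain u w where p: "p = (u, w)" "0 < w" "w \<le> x" by auto
    then obtain u' w' where "0 < u'" "u' \<le> w" "0 < w'" "w' \<le> w" "inf u' w' = 0"
      using split by blast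
    with p show ?case
      by (intro exI[of _ "(u', w')"]) auto
  qed
  then obtain f where f: "\<And>n. (case f n of (u, w) \<Rightarrow> 0 < u \<and> 0 < w \<and> w \<le> x \<and> inf u w = 0) \<and>
      (case f n of (u, w) \<Rightarrow> case f (Suc n) of (u', w') \<Rightarrow> u' \<le> w \<and> w' \<le> w)"
    by blast
  define u where "u n = fst (f n)" for n
  define w where "w n = snd (f n)" for n
  have uw: "0 < u n" "0 < w n" "inf (u n) (w n) = 0" "u (Suc n) \<le> w n" "w (Suc n) \<le> w n" for n
    using f[of n] by (auto simp: u_def w_def split: prod.splits)
  have dec: "w m \<le> w n" if "n \<le> m" for n m
    using lift_Suc_antimono_le[of w, OF uw(5) that] .
  have lt: "inf (u n) (u m) = 0" if "n < m" for n m
  proof -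
    from \<open>n < m\<close> obtain k where "m = Suc (n + k)" using less_imp_Suc_add by blast
    \<comment> \<open>All later terms lie below \<open>w n\<close>, which is disjoint from
      \<open>u n\<close>.\<close>
    then have "u m \<le> w n" using uw(4)[of "n + k"] dec[of n "n + k"] by simp
    then show ?thesis
      using uw(1) by (intro inf_eq_0_mono[OF uw(3)[of n]]) (simp_all add: less_imp_le)
  qed
  have "inf (u n) (u m) = 0" if "n \<noteq> m" for n m
    using that lt[of n m] lt[of m n] by (cases "n < m") (auto simp: inf_commute)
  with uw show ?thesis by blast
qed

text \<open>If some positive vector has no atom below it, repeated splitting works. Otherwise a
  maximal disjoint set of atoms is infinite, since a finite one would span the space.\<close>

lemma infinite_dim_disjoint_seq:
  assumes inf_dim: "\<nexists>B :: 'a::banach_lattice set. finite B \<and> span B = UNIV"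
  shows "\<exists>u :: nat \<Rightarrow> 'a. (\<forall>n. 0 < u n) \<and> (\<forall>n m. n \<noteq> m \<longrightarrow> inf (u n) (u m) = 0)"
proof (cases "\<forall>x::'a. 0 < x \<longrightarrow> (\<exists>a\<le>x. lattice_atom a)")
  case False
  then show ?thesis
    using disjoint_seq_below_atomless by blast
next
  case True
  let ?A = "{F :: 'a set. (\<forall>a\<in>F. lattice_atom a) \<and> pairwise (\<lambda>a b. inf a b = 0) F}"
  have "\<exists>M\<in>?A. \<forall>X\<in>?A. M \<subseteq> X \<longrightarrow> X = M"
  proof (rule subset_Zorn')
    fix C assume C: "subset.chain ?A C"
    have "pairwise (\<lambda>a b. inf a b = 0) (\<Union>C)"
      unfolding pairwise_def
    proof (intro ballI impI)
      fix a b assume "a \<in> \<Union>C" "b \<in> \<Union>C" "a \<noteq> b"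
      then obtain X where "X \<in> C" "a \<in> X" "b \<in> X"
        using C unfolding subset_chain_def by (metis UnionE subsetD)
      then show "inf a b = 0"
        using C \<open>a \<noteq> b\<close> by (auto simp: subset_chain_def pairwise_def)
    qed
    then show "\<Union>C \<in> ?A"
      using C by (auto simp: subset_chain_def)
  qed
  then obtain M where M: "\<forall>a\<in>M. lattice_atom a" "pairwise (\<lambda>a b. inf a b = 0) M"
    and max: "\<And>X. X \<in> ?A \<Longrightarrow> M \<subseteq> X \<Longrightarrow> X = M"
    by auto
  have "infinite M"
  proof
    assume fin: "finite M"
    have pos: "x \<in> span M" if x: "0 \<le> x" for x
    proof -
      obtain y where y: "x - y \<in> span M" "0 \<le> y" "\<forall>a\<in>M. inf y a = 0"
        using finite_atoms_decomposition[OF fin _ x] M by blast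
      \<comment> \<open>An atom below a nonzero remainder would be disjoint from all of
        \<open>M\<close>. Maximality puts it in \<open>M\<close>, so it would be disjoint from
        itself.\<close>
      have "y = 0"
      proof (rule ccontr)
        assume "y \<noteq> 0"
        then obtain a where a: "a \<le> y" "lattice_atom a"
          using True y(2) by (metis order.not_eq_order_implies_strict)
        have a0: "0 < a" using a by (simp add: lattice_atom_def)
        have dis: "inf a b = 0" if "b \<in> M" for b
          using M(1) that a(1) a0
          by (intro inf_eq_0_mono[OF bspec[OF y(3) that]]) (simp_all add: lattice_atom_def less_imp_le)
        then have "insert a M \<in> ?A"
          using M a by (auto simp: pairwise_insert inf_commute)
        then have "a \<in> M" using max by blast
        with dis[of a] a0 show False by simp
      qed
      with y show ?thesis by simp
    qed
    have "x \<in> span M" for x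
    proof -
      \<comment> \<open>Every vector is a difference of two positive ones.\<close>
      have "\<bar>x\<bar> - (\<bar>x\<bar> - x) \<in> span M"
        by (intro span_diff pos) (auto intro: abs_ge_self)
      then show ?thesis by simp
    qed
    with fin inf_dim show False by blast
  qed
  then obtain u :: "nat \<Rightarrow> 'a" where u: "inj u" "range u \<subseteq> M"
    using infinite_countable_subset by blast
  have "0 < u n" for n
    using u M by (auto simp: lattice_atom_def)
  moreover have "inf (u n) (u m) = 0" if "n \<noteq> m" for n m
    using pairwiseD[OF M(2), of "u n" "u m"] u that by (auto simp: inj_eq)
  ultimately show ?thesis by blast
qed

section \<open>The positive operator that is not M-weakly compact, and the equivalence\<close>

lemma infinite_dim_not_M_weakly_compact:
  assumes "\<nexists>B :: 'a set. finite B \<and> span B = UNIV"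
  obtains T :: "'a::banach_lattice \<Rightarrow> l_infinity"
  where "positive_operator T" "bounded_linear T" "\<not> M_weakly_compact T"
proof -
  obtain u :: "nat \<Rightarrow> 'a" where u: "\<And>n. 0 < u n" "\<And>n m. n \<noteq> m \<Longrightarrow> inf (u n) (u m) = 0"
    using infinite_dim_disjoint_seq[OF assms] by blast
  define e where "e n = inverse (norm (u n)) *\<^sub>R u n" for n
  have u_norm: "0 < norm (u n)" for n
    using u(1)[of n] by auto
  have e0: "0 \<le> e n" and e1: "norm (e n) = 1" for n
    using u(1)[of n] u_norm[of n] by (auto simp: e_def intro: scaleR_nonneg_nonneg)
  have dis: "inf (e n) (e m) = 0" if "n \<noteq> m" for n m
  proof -
    have "inf (e n) (u m) = 0"
      unfolding e_def using u(2)[OF that] by (intro inf_scaleR_eq_0) auto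
    then have "inf (e m) (e n) = 0"
      unfolding e_def[of m] by (intro inf_scaleR_eq_0) (auto simp: inf_commute)
    then show ?thesis by (simp add: inf_commute)
  qed
  have "\<exists>f :: 'a \<Rightarrow> real. linear f \<and> (\<forall>x\<ge>0. 0 \<le> f x) \<and> (\<forall>x. \<bar>f x\<bar> \<le> norm x) \<and> f (e n) = 1" for n
    using positive_norming_functional[OF e0[of n]] e1[of n] by metis
  then obtain f :: "nat \<Rightarrow> 'a \<Rightarrow> real" where f: "\<And>n. linear (f n)" "\<And>n x. 0 \<le> x \<Longrightarrow> 0 \<le> f n x"
    "\<And>n x. \<bar>f n x\<bar> \<le> norm x" "\<And>n. f n (e n) = 1"
    by metis
  define T :: "'a \<Rightarrow> l_infinity" where "T x = Bcontfun (\<lambda>n. f n x)" for x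
  have T: "apply_bcontfun (T x) n = f n x" for x n
  proof -
    \<comment> \<open>The bound \<open>norm x\<close>, uniform in \<open>n\<close>, makes the
      sequence of values an element of \<open>l_infinity\<close>.\<close>
    have "(\<lambda>n. f n x) \<in> bcontfun"
      using f(3) by (intro bcontfun_normI[where b="norm x"]) auto
    then show ?thesis by (simp add: T_def Bcontfun_inverse)
  qed
  have T_bounded: "bounded_linear T"
  proof (rule bounded_linear_intro[where K=1])
    show "T (x + y) = T x + T y" for x y
      by (rule bcontfun_eqI) (simp add: T linear_add[OF f(1)])
    show "T (c *\<^sub>R x) = c *\<^sub>R T x" for c x
      by (rule bcontfun_eqI) (simp add: T linear_scale[OF f(1)])
    show "norm (T x) \<le> norm x * 1" for x
      by (rule norm_bound) (simp add: T f(3))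
  qed
  show ?thesis
  proof
    show "positive_operator T"
      using bounded_linear.linear[OF T_bounded] f(2)
      by (auto simp: positive_operator_def less_eq_bcontfun.rep_eq T)
    show "bounded_linear T" by fact
    show "\<not> M_weakly_compact T"
    proof
      assume "M_weakly_compact T"
      moreover have "bounded (range e)"
        using e1 by (auto simp: bounded_iff)
      moreover have "disjoint_seq e"
        using dis e0 by (auto simp: disjoint_seq_def)
      ultimately have "(\<lambda>n. norm (T (e n))) \<longlonglongrightarrow> 0"
        by (auto simp: M_weakly_compact_def)
      \<comment> \<open>The coordinate of \<open>T (e n)\<close> at index \<open>n\<close> is
        \<open>f n (e n) = 1\<close>.\<close>
      moreover have "1 \<le> norm (T (e n))" for n
        using norm_bounded[of "T (e n)" n] f(4)[of n] by (simp add: T)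
      ultimately have "(1::real) \<le> 0"
        by (intro tendsto_lowerbound[of _ 0 sequentially 1]) auto
      then show False by simp
    qed
  qed
qed

theorem theorem3p18:
  shows "(\<exists>B :: 'a::banach_lattice set. finite B \<and> span B = UNIV) \<longleftrightarrow>
    (\<forall>T :: 'a \<Rightarrow> l_infinity.
      positive_operator T \<and> disjointly_weakly_compact T \<longrightarrow> M_weakly_compact T)"
proof
  assume "\<exists>B :: 'a set. finite B \<and> span B = UNIV"
  then show "\<forall>T :: 'a \<Rightarrow> l_infinity.
      positive_operator T \<and> disjointly_weakly_compact T \<longrightarrow> M_weakly_compact T"
    by (auto simp: disjointly_weakly_compact_def intro: M_weakly_compact_finite_dim)
next
  assume M: "\<forall>T :: 'a \<Rightarrow> l_infinity.
      positive_operator T \<and> disjointly_weakly_compact T \<longrightarrow> M_weakly_compact T"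
  show "\<exists>B :: 'a set. finite B \<and> span B = UNIV"
  proof (rule ccontr)
    assume "\<nexists>B :: 'a set. finite B \<and> span B = UNIV"
    then obtain T :: "'a \<Rightarrow> l_infinity"
      where "positive_operator T" "bounded_linear T" "\<not> M_weakly_compact T"
      using infinite_dim_not_M_weakly_compact by blast
    with M l_infinity_disjointly_weakly_compact show False
      by blast
  qed
qed

end
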